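(* Let $\pi$ be a link pattern of size $N$, and let $\underline\pi$ be its permutation matrix with the diagonal zeroed out. Then the set $$U\cdot\{\underline\pi\, t : t\in M_N(\mathbb C)\text{ diagonal}\}$$ is irreducible, is contained in $E_\pi$, and is dense in $E_\pi$, where $U$ acts by $\bullet$-conjugation. Equivalently, $E_\pi=\overline{U\cdot\{\underline\pi\, t: t\text{ diagonal}\}}$.
   Context: Let $N=2n+r$ be a positive integer with $r\in\{0,1\}$. A sequence $(i_1,\dots,i_k)\in\{1,\dots,N\}^k$ is cyclically ordered, written $\circlearrowleft(i_1\le\dots\le i_k)$, if for some $j$ the rotated sequence $(i_j,\dots,i_k,i_1,\dots,i_{j-1})$ is weakly increasing, with the additional condition that all the $i$'s are equal if $i_1=i_k$. On $M_N(\mathbb C)$ define the associative product $(P\bullet Q)_{ik}=\sum_{j:\ \circlearrowleft(i\le j\le k)}P_{ij}Q_{jk}$, whose unit is the identity matrix; a matrix $P$ has an inverse $P^{\bullet -1}$ for $\bullet$ iff all its diagonal entries are nonzero. The set $U=\{M\in M_N(\mathbb C):M_{ii}=1,\ i=1,\dots,N\}$ is a group under $\bullet$; it acts by $\bullet$-conjugation, $P\cdot M=P\bullet M\bullet P^{\bullet-1}$. The Brauer loop scheme $E\subseteq M_N(\mathbb C)$ is defined by $M\bullet M=0$ and $M_{ii}=0$ for all $i$. A link pattern is an involution of $\{1,\dots,N\}$ with exactly $r$ fixed points. For a link pattern $\pi$, $$E_\pi:=\overline{\{M\in E:(M^2)_{ii}=(M^2)_{jj}\text{ if and only if }j\in\{i,\pi(i)\}\}},$$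 with $M^2$ the ordinary square. The product $\underline\pi\,t$ is the ordinary matrix product. *)

theory Defs
  imports
    "HOL-Analysis.Abstract_Topology"
    "HOL-Combinatorics.Permutations"
    "Jordan_Normal_Form.Matrix"
begin

text \<open>Matrices in $M_N(\mathbb{C})$ are elements of \<^term>\<open>carrier_mat N N :: complex mat set\<close>, so the index
  set is $\{0,\dots,N-1\}$ instead of $\{1,\dots,N\}$.\<close>

definition cyc_ordered :: "nat list \<Rightarrow> bool" where
  "cyc_ordered is \<longleftrightarrow>
     (\<exists>j. sorted (rotate j is)) \<and> (hd is = last is \<longrightarrow> (\<forall>a \<in> set is. \<forall>b \<in> set is. a = b))"

definition bullet :: "complex mat \<Rightarrow> complex mat \<Rightarrow> complex mat" (infixl "\<star>" 70) where
  "P \<star> Q = mat (dim_row P) (dim_col Q)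
     (\<lambda>(i, k). \<Sum>j | j < dim_col P \<and> cyc_ordered [i, j, k]. P $$ (i, j) * Q $$ (j, k))"

definition bullet_monoid :: "nat \<Rightarrow> complex mat monoid" where
  "bullet_monoid N = \<lparr>carrier = carrier_mat N N, mult = (\<star>), one = 1\<^sub>m N\<rparr>"

lemma cyc_ordered3_iff:
  "cyc_ordered [i, j, k] \<longleftrightarrow>
     (if i \<le> k then i \<le> j \<and> j \<le> k else i \<le> j \<or> j \<le> k)"
proof -
  have rot: "rotate m [i, j, k] \<in> {[i, j, k], [j, k, i], [k, i, j]}" for m
  proof (induction m)
    case (Suc m)
    then show ?case
      by (elim insertE emptyE) (simp_all only: rotate_Suc rotate1.simps append.simps, simp_all)
  qed simp
  have "rotate 0 [i, j, k] = [i, j, k]" "rotate 1 [i, j, k] = [j, k, i]"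
    "rotate 2 [i, j, k] = [k, i, j]"
    by (simp_all add: numeral_2_eq_2)
  then have "\<exists>m. sorted (rotate m [i, j, k])"
    if "sorted [i, j, k] \<or> sorted [j, k, i] \<or> sorted [k, i, j]"
    using that by (elim disjE) (rule exI, erule (1) ssubst)+
  moreover have "sorted [i, j, k] \<or> sorted [j, k, i] \<or> sorted [k, i, j]"
    if "sorted (rotate m [i, j, k])" for m
    using rot[of m] that by (elim insertE emptyE) (simp_all only: simp_thms)
  ultimately have "(\<exists>m. sorted (rotate m [i, j, k])) \<longleftrightarrow>
      sorted [i, j, k] \<or> sorted [j, k, i] \<or> sorted [k, i, j]"
    by blast
  then show ?thesis
    unfolding cyc_ordered_def by auto
qed

lemma bullet_carrier:
  "P \<in> carrier_mat N N \<Longrightarrow> Q \<in> carrier_mat N N \<Longrightarrow> P \<star> Q \<in> carrier_mat N N"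
  by (auto simp: bullet_def)

lemma bullet_index:
  assumes "P \<in> carrier_mat N N" "Q \<in> carrier_mat N N" "i < N" "k < N"
  shows "(P \<star> Q) $$ (i, k) =
    (\<Sum>j<N. if cyc_ordered [i, j, k] then P $$ (i, j) * Q $$ (j, k) else 0)"
  using assms sum.inter_filter[of "{..<N}" "\<lambda>j. P $$ (i, j) * Q $$ (j, k)" "\<lambda>j. cyc_ordered [i, j, k]"]
  by (simp add: bullet_def)

lemma bullet_assoc:
  assumes P: "P \<in> carrier_mat N N" and Q: "Q \<in> carrier_mat N N" and R: "R \<in> carrier_mat N N"
  shows "(P \<star> Q) \<star> R = P \<star> (Q \<star> R)"
proof (rule eq_matI)
  have PQ: "P \<star> Q \<in> carrier_mat N N" and QR: "Q \<star> R \<in> carrier_mat N N"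
    using assms by (auto intro: bullet_carrier)
  fix i l assume "i < dim_row (P \<star> (Q \<star> R))" "l < dim_col (P \<star> (Q \<star> R))"
  then have il: "i < N" "l < N"
    using bullet_carrier[OF P QR] by auto
  have cyc: "cyc_ordered [i, k, l] \<and> cyc_ordered [i, j, k] \<longleftrightarrow>
      cyc_ordered [i, j, l] \<and> cyc_ordered [j, k, l]" for j k
    unfolding cyc_ordered3_iff by auto
  have "((P \<star> Q) \<star> R) $$ (i, l) =
      (\<Sum>k<N. \<Sum>j<N. if cyc_ordered [i, k, l] \<and> cyc_ordered [i, j, k]
        then P $$ (i, j) * Q $$ (j, k) * R $$ (k, l) else 0)"
    by (subst bullet_index[OF PQ R il], rule sum.cong)
       (auto simp: bullet_index[OF P Q il(1)] sum_distrib_right intro!: sum.cong)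
  also have "\<dots> = (\<Sum>j<N. \<Sum>k<N. if cyc_ordered [i, j, l] \<and> cyc_ordered [j, k, l]
        then P $$ (i, j) * Q $$ (j, k) * R $$ (k, l) else 0)"
    unfolding cyc by (rule sum.swap)
  also have "\<dots> = (P \<star> (Q \<star> R)) $$ (i, l)"
    by (subst bullet_index[OF P QR il], rule sum.cong)
       (auto simp: bullet_index[OF Q R _ il(2)] sum_distrib_left mult.assoc intro!: sum.cong)
  finally show "((P \<star> Q) \<star> R) $$ (i, l) = (P \<star> (Q \<star> R)) $$ (i, l)" .
qed (auto simp: bullet_def)

lemma bullet_one:
  assumes P: "P \<in> carrier_mat N N"
  shows "1\<^sub>m N \<star> P = P" "P \<star> 1\<^sub>m N = P"
proof -
  have "(1\<^sub>m N \<star> P) $$ (i, k) = P $$ (i, k)" "(P \<star> 1\<^sub>m N) $$ (i, k) = P $$ (i, k)"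
    if ik: "i < N" "k < N" for i k
  proof -
    have "(1\<^sub>m N \<star> P) $$ (i, k) = (\<Sum>j<N. if j = i then P $$ (i, k) else 0)"
      using P ik by (subst bullet_index[where N = N], simp, simp, simp, simp, intro sum.cong)
        (auto simp: cyc_ordered3_iff)
    then show "(1\<^sub>m N \<star> P) $$ (i, k) = P $$ (i, k)"
      using ik by simp
    have "(P \<star> 1\<^sub>m N) $$ (i, k) = (\<Sum>j<N. if j = k then P $$ (i, k) else 0)"
      using P ik by (subst bullet_index[where N = N], simp, simp, simp, simp, intro sum.cong)
        (auto simp: cyc_ordered3_iff)
    then show "(P \<star> 1\<^sub>m N) $$ (i, k) = P $$ (i, k)"
      using ik by simp
  qed
  with P show "1\<^sub>m N \<star> P = P" "P \<star> 1\<^sub>m N = P"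
    by (auto intro!: eq_matI simp: bullet_def)
qed

lemma monoid_bullet: "monoid (bullet_monoid N)"
  by (rule monoidI)
     (auto simp: bullet_monoid_def bullet_assoc bullet_one intro: bullet_carrier)

definition bullet_inv :: "nat \<Rightarrow> complex mat \<Rightarrow> complex mat" where
  "bullet_inv N P = inv\<^bsub>bullet_monoid N\<^esub> P"

definition unit_diag_group :: "nat \<Rightarrow> complex mat set" where
  "unit_diag_group N = {M \<in> carrier_mat N N. \<forall>i<N. M $$ (i, i) = 1}"

definition bullet_orbit :: "nat \<Rightarrow> complex mat set \<Rightarrow> complex mat set" where
  "bullet_orbit N D = {P \<star> M \<star> bullet_inv N P | P M. P \<in> unit_diag_group N \<and> M \<in> D}"

text \<open>Polynomial functions in the $N^2$ matrix entries.\<close>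

inductive_set poly_funs :: "nat \<Rightarrow> (complex mat \<Rightarrow> complex) set" for N :: nat where
  const: "(\<lambda>_. c) \<in> poly_funs N"
| entry: "i < N \<Longrightarrow> j < N \<Longrightarrow> (\<lambda>M. M $$ (i, j)) \<in> poly_funs N"
| add: "f \<in> poly_funs N \<Longrightarrow> g \<in> poly_funs N \<Longrightarrow> (\<lambda>M. f M + g M) \<in> poly_funs N"
| mult: "f \<in> poly_funs N \<Longrightarrow> g \<in> poly_funs N \<Longrightarrow> (\<lambda>M. f M * g M) \<in> poly_funs N"

definition zero_locus :: "nat \<Rightarrow> (complex mat \<Rightarrow> complex) set \<Rightarrow> complex mat set" where
  "zero_locus N F = {M \<in> carrier_mat N N. \<forall>f \<in> F. f M = 0}"

definition zariski :: "nat \<Rightarrow> complex mat topology" where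
  "zariski N = topology (\<lambda>V. \<exists>F \<subseteq> poly_funs N. V = carrier_mat N N - zero_locus N F)"

lemma istopology_zariski:
  "istopology (\<lambda>V. \<exists>F \<subseteq> poly_funs N. V = carrier_mat N N - zero_locus N F)"
  unfolding istopology_def
proof (intro conjI allI impI)
  fix S T
  assume "\<exists>F \<subseteq> poly_funs N. S = carrier_mat N N - zero_locus N F"
    and "\<exists>F \<subseteq> poly_funs N. T = carrier_mat N N - zero_locus N F"
  then obtain F G where F: "F \<subseteq> poly_funs N" "S = carrier_mat N N - zero_locus N F"
    and G: "G \<subseteq> poly_funs N" "T = carrier_mat N N - zero_locus N G"
    by blast
  let ?H = "{\<lambda>M. f M * g M | f g. f \<in> F \<and> g \<in> G}"
  have "?H \<subseteq> poly_funs N"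
    using F(1) G(1) by (auto intro: poly_funs.mult)
  moreover have "S \<inter> T = carrier_mat N N - zero_locus N ?H"
    unfolding F(2) G(2) zero_locus_def by fastforce
  ultimately show "\<exists>F \<subseteq> poly_funs N. S \<inter> T = carrier_mat N N - zero_locus N F"
    by blast
next
  fix K
  assume "\<forall>V \<in> K. \<exists>F \<subseteq> poly_funs N. V = carrier_mat N N - zero_locus N F"
  then obtain F where F: "\<And>V. V \<in> K \<Longrightarrow> F V \<subseteq> poly_funs N"
    "\<And>V. V \<in> K \<Longrightarrow> V = carrier_mat N N - zero_locus N (F V)"
    by metis
  have "\<Union>K = (\<Union>V \<in> K. carrier_mat N N - zero_locus N (F V))"
    using F(2) by auto
  also have "\<dots> = carrier_mat N N - zero_locus N (\<Union>V \<in> K. F V)"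
    unfolding zero_locus_def by auto
  finally show "\<exists>F \<subseteq> poly_funs N. \<Union>K = carrier_mat N N - zero_locus N F"
    using F(1) by (intro exI[of _ "\<Union>V \<in> K. F V"]) auto
qed

lemma openin_zariski:
  "openin (zariski N) V \<longleftrightarrow> (\<exists>F \<subseteq> poly_funs N. V = carrier_mat N N - zero_locus N F)"
  unfolding zariski_def by (simp add: topology_inverse'[OF istopology_zariski])

lemma topspace_zariski: "topspace (zariski N) = carrier_mat N N"
proof -
  have "openin (zariski N) (carrier_mat N N)"
    unfolding openin_zariski zero_locus_def
    by (intro exI[of _ "{\<lambda>_. 1}"]) (auto intro: poly_funs.const)
  then show ?thesis
    unfolding topspace_def openin_zariski by blast
qed

lemma closedin_zariski:
  "closedin (zariski N) Z \<longleftrightarrow> (\<exists>F \<subseteq> poly_funs N. Z = zero_locus N F)"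
proof -
  have "zero_locus N F \<subseteq> carrier_mat N N" for F
    by (auto simp: zero_locus_def)
  then show ?thesis
    unfolding closedin_def topspace_zariski openin_zariski
    by (metis double_diff subset_refl)
qed

definition irreducible_space :: "'a topology \<Rightarrow> bool" where
  "irreducible_space X \<longleftrightarrow> topspace X \<noteq> {} \<and>
     (\<forall>A B. closedin X A \<and> closedin X B \<and> A \<union> B = topspace X \<longrightarrow>
        A = topspace X \<or> B = topspace X)"

definition brauer_loop_scheme :: "nat \<Rightarrow> complex mat set" where
  "brauer_loop_scheme N =
     {M \<in> carrier_mat N N. M \<star> M = 0\<^sub>m N N \<and> (\<forall>i<N. M $$ (i, i) = 0)}"

definition link_pattern :: "nat \<Rightarrow> nat \<Rightarrow> (nat \<Rightarrow> nat) \<Rightarrow> bool" where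
  "link_pattern N r \<pi> \<longleftrightarrow>
     \<pi> permutes {..<N} \<and> (\<forall>i<N. \<pi> (\<pi> i) = i) \<and> card {i. i < N \<and> \<pi> i = i} = r"

definition brauer_component :: "nat \<Rightarrow> (nat \<Rightarrow> nat) \<Rightarrow> complex mat set" where
  "brauer_component N \<pi> = zariski N closure_of
     {M \<in> brauer_loop_scheme N.
        \<forall>i<N. \<forall>j<N. (M * M) $$ (i, i) = (M * M) $$ (j, j) \<longleftrightarrow> j \<in> {i, \<pi> i}}"

definition underline_perm :: "nat \<Rightarrow> (nat \<Rightarrow> nat) \<Rightarrow> complex mat" where
  "underline_perm N \<pi> = mat N N (\<lambda>(i, j). if i = \<pi> j \<and> i \<noteq> j then 1 else 0)"

end

(* If M lies in the Brauer loop scheme, then its ordinary square M^2 commutes with M for the bullet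
   product, and the diagonal of M^2 is invariant under U. When this diagonal separates the pairs
   {i, pi i}, a bullet conjugation by U block-diagonalises M^2 along these pairs; the conjugate of M
   commutes with the result, so it is block-diagonal too, hence of the form (underlined pi) t. So the
   generic part of E_pi lies in the orbit. Conversely, orbit points lie on polynomial curves
   s |-> P_s . (underlined pi) t_s in the orbit; a curve through a generic point is generic for almost
   all s, and a curve through two given points yields irreducibility, as C[s] is a domain. *)

theory Submission
  imports Defs "HOL-Computational_Algebra.Polynomial"
begin

section \<open>Cyclic distance as the induction measure for the bullet product\<close>

definition cyc_dist :: "nat \<Rightarrow> nat \<Rightarrow> nat \<Rightarrow> nat" where
  "cyc_dist N i k = (if i \<le> k then k - i else N + k - i)"

text \<open>An intermediate index splits the distance into two positive summands, so inductions on
  \<open>cyc_dist\<close> control the inner terms of a bullet product. For equal ends the cyclic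
  order admits no third index, whence \<open>i \<noteq> k\<close>.\<close>

lemma cyc_dist_between:
  assumes "cyc_ordered [i, j, k]" "j \<noteq> i" "j \<noteq> k" "i < N" "j < N" "k < N"
  shows "cyc_dist N i j < cyc_dist N i k" "cyc_dist N j k < cyc_dist N i k" "i \<noteq> k"
  using assms unfolding cyc_ordered3_iff cyc_dist_def by (auto split: if_splits)

lemma cyc_dist_less: "i < N \<Longrightarrow> k < N \<Longrightarrow> cyc_dist N i k < N"
  unfolding cyc_dist_def by auto

lemma bullet_diag:
  assumes "P \<in> carrier_mat N N" "Q \<in> carrier_mat N N" "i < N"
  shows "(P \<star> Q) $$ (i, i) = P $$ (i, i) * Q $$ (i, i)"
proof -
  have "(P \<star> Q) $$ (i, i) = (\<Sum>j<N. if j = i then P $$ (i, i) * Q $$ (i, i) else 0)"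
    by (subst bullet_index[OF assms(1,2,3,3)], intro sum.cong) (auto simp: cyc_ordered3_iff)
  then show ?thesis
    using assms(3) by simp
qed

text \<open>Once the terms made of strictly shorter steps vanish, only \<open>j = i\<close> and
  \<open>j = k\<close> are left. Thus \<star> behaves like a triangular product, and the later
  arguments solve for entries distance by distance.\<close>

lemma bullet_index_ends:
  assumes P: "P \<in> carrier_mat N N" and Q: "Q \<in> carrier_mat N N" and ik: "i < N" "k < N" "i \<noteq> k"
    and mid: "\<And>j. j < N \<Longrightarrow> j \<noteq> i \<Longrightarrow> j \<noteq> k \<Longrightarrow> cyc_dist N i j < cyc_dist N i k \<Longrightarrow>
      cyc_dist N j k < cyc_dist N i k \<Longrightarrow> P $$ (i, j) * Q $$ (j, k) = 0"
  shows "(P \<star> Q) $$ (i, k) = P $$ (i, i) * Q $$ (i, k) + P $$ (i, k) * Q $$ (k, k)"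
proof -
  have "(P \<star> Q) $$ (i, k) =
      (\<Sum>j\<in>{i, k}. if cyc_ordered [i, j, k] then P $$ (i, j) * Q $$ (j, k) else 0)"
    unfolding bullet_index[OF P Q ik(1,2)]
  proof (rule sum.mono_neutral_right)
    show "\<forall>j\<in>{..<N} - {i, k}. (if cyc_ordered [i, j, k] then P $$ (i, j) * Q $$ (j, k) else 0) = 0"
      using mid cyc_dist_between ik by (metis DiffE insertCI lessThan_iff)
  qed (use ik in auto)
  then show ?thesis
    using ik by (simp add: cyc_ordered3_iff)
qed

section \<open>The complementary product and the ordinary square\<close>

text \<open>Lifting matrices to periodic upper triangular matrices over $\mathbb{Z} \times \mathbb{Z}$ turns
  \<open>P \<star> Q\<close> into the entries $(i,k)$ with $i \le k < i+N$ of the product; the complementary sum below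
  gives the entries $(i,k+N)$ of the product of the lifts supported on $i \le k < i+N$.\<close>

definition cobullet :: "complex mat \<Rightarrow> complex mat \<Rightarrow> complex mat" (infixl "\<diamond>" 70) where
  "P \<diamond> Q = mat (dim_row P) (dim_col Q)
     (\<lambda>(i, k). \<Sum>j | j < dim_col P \<and> \<not> cyc_ordered [i, j, k]. P $$ (i, j) * Q $$ (j, k))"

lemma cobullet_carrier:
  "P \<in> carrier_mat N N \<Longrightarrow> Q \<in> carrier_mat N N \<Longrightarrow> P \<diamond> Q \<in> carrier_mat N N"
  by (auto simp: cobullet_def)

lemma cobullet_index:
  assumes "P \<in> carrier_mat N N" "Q \<in> carrier_mat N N" "i < N" "k < N"
  shows "(P \<diamond> Q) $$ (i, k) =
    (\<Sum>j<N. if \<not> cyc_ordered [i, j, k] then P $$ (i, j) * Q $$ (j, k) else 0)"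
  using assms sum.inter_filter[of "{..<N}" "\<lambda>j. P $$ (i, j) * Q $$ (j, k)" "\<lambda>j. \<not> cyc_ordered [i, j, k]"]
  by (simp add: cobullet_def)

lemma times_eq_bullet_cobullet:
  assumes P: "P \<in> carrier_mat N N" and Q: "Q \<in> carrier_mat N N"
  shows "P * Q = P \<star> Q + P \<diamond> Q"
proof (rule eq_matI)
  fix i k assume "i < dim_row (P \<star> Q + P \<diamond> Q)" "k < dim_col (P \<star> Q + P \<diamond> Q)"
  then have ik: "i < N" "k < N"
    using cobullet_carrier[OF P Q] by auto
  have "(P * Q) $$ (i, k) = (\<Sum>j<N. P $$ (i, j) * Q $$ (j, k))"
    using P Q ik by (auto simp: scalar_prod_def lessThan_atLeast0 intro!: sum.cong)
  also have "\<dots> = (P \<star> Q) $$ (i, k) + (P \<diamond> Q) $$ (i, k)"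
    unfolding bullet_index[OF P Q ik] cobullet_index[OF P Q ik] sum.distrib[symmetric]
    by (rule sum.cong) auto
  finally show "(P * Q) $$ (i, k) = (P \<star> Q + P \<diamond> Q) $$ (i, k)"
    using ik cobullet_carrier[OF P Q] by simp
qed (use P Q in \<open>auto simp: cobullet_def\<close>)

text \<open>Weighting \<diamond> by a formal parameter \<open>e\<close> gives an associative product
  that interpolates between \<star> at \<open>e = 0\<close> and the matrix product at
  \<open>e = 1\<close>. This law is the degree one part in \<open>e\<close> of its
  associativity.\<close>

lemma bullet_cobullet_assoc:
  assumes A: "A \<in> carrier_mat N N" and B: "B \<in> carrier_mat N N" and C: "C \<in> carrier_mat N N"
  shows "A \<star> (B \<diamond> C) + A \<diamond> (B \<star> C) = (A \<diamond> B) \<star> C + (A \<star> B) \<diamond> C"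
proof (rule eq_matI)
  note car = bullet_carrier[OF A B] bullet_carrier[OF B C] cobullet_carrier[OF A B] cobullet_carrier[OF B C]
  note car2 = bullet_carrier[OF A car(4)] bullet_carrier[OF car(3) C]
    cobullet_carrier[OF A car(2)] cobullet_carrier[OF car(1) C]
  fix i l assume "i < dim_row ((A \<diamond> B) \<star> C + (A \<star> B) \<diamond> C)" "l < dim_col ((A \<diamond> B) \<star> C + (A \<star> B) \<diamond> C)"
  then have il: "i < N" "l < N"
    using car2 by auto
  \<comment> \<open>Both sides sum over the paths of winding number 1.\<close>
  have cyc: "cyc_ordered [i, j, l] \<noteq> cyc_ordered [j, k, l] \<longleftrightarrow>
      cyc_ordered [i, k, l] \<noteq> cyc_ordered [i, j, k]" for j k
    unfolding cyc_ordered3_iff by auto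
  have "(A \<star> (B \<diamond> C)) $$ (i, l) + (A \<diamond> (B \<star> C)) $$ (i, l) =
      (\<Sum>j<N. \<Sum>k<N. if cyc_ordered [i, j, l] \<noteq> cyc_ordered [j, k, l]
        then A $$ (i, j) * B $$ (j, k) * C $$ (k, l) else 0)"
    unfolding bullet_index[OF A car(4) il] cobullet_index[OF A car(2) il] sum.distrib[symmetric]
    by (rule sum.cong) (auto simp: bullet_index[OF B C _ il(2)] cobullet_index[OF B C _ il(2)]
        sum_distrib_left mult.assoc intro!: sum.cong)
  also have "\<dots> = (\<Sum>k<N. \<Sum>j<N. if cyc_ordered [i, k, l] \<noteq> cyc_ordered [i, j, k]
        then A $$ (i, j) * B $$ (j, k) * C $$ (k, l) else 0)"
    unfolding cyc by (rule sum.swap)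
  also have "\<dots> = ((A \<diamond> B) \<star> C) $$ (i, l) + ((A \<star> B) \<diamond> C) $$ (i, l)"
    unfolding bullet_index[OF car(3) C il] cobullet_index[OF car(1) C il] sum.distrib[symmetric]
    by (rule sum.cong) (auto simp: bullet_index[OF A B il(1)] cobullet_index[OF A B il(1)]
        sum_distrib_right intro!: sum.cong)
  finally show "(A \<star> (B \<diamond> C) + A \<diamond> (B \<star> C)) $$ (i, l) = ((A \<diamond> B) \<star> C + (A \<star> B) \<diamond> C) $$ (i, l)"
    using car2 il by simp
qed (use assms in \<open>auto simp: bullet_def cobullet_def\<close>)

lemma bullet_zero:
  "P \<in> carrier_mat N N \<Longrightarrow> P \<star> 0\<^sub>m N N = 0\<^sub>m N N" "P \<in> carrier_mat N N \<Longrightarrow> 0\<^sub>m N N \<star> P = 0\<^sub>m N N"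
  "P \<in> carrier_mat N N \<Longrightarrow> P \<diamond> 0\<^sub>m N N = 0\<^sub>m N N" "P \<in> carrier_mat N N \<Longrightarrow> 0\<^sub>m N N \<diamond> P = 0\<^sub>m N N"
  by (auto simp: bullet_def cobullet_def intro!: eq_matI sum.neutral)

lemma brauer_loop_schemeD:
  assumes "M \<in> brauer_loop_scheme N"
  shows "M \<in> carrier_mat N N" "M \<star> M = 0\<^sub>m N N" "i < N \<Longrightarrow> M $$ (i, i) = 0"
  using assms by (auto simp: brauer_loop_scheme_def)

lemma square_eq_cobullet:
  assumes "M \<in> brauer_loop_scheme N"
  shows "M * M = M \<diamond> M"
  using times_eq_bullet_cobullet[of M N M] brauer_loop_schemeD[OF assms] cobullet_carrier[of M N M]
  by simp

text \<open>With all three factors equal to \<open>M\<close>, the terms of the mixed law that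
  contain \<open>M \<star> M\<close> drop out, and \<open>M \<diamond> M\<close> is the ordinary
  square.\<close>

lemma bullet_square_commute:
  assumes "M \<in> brauer_loop_scheme N"
  shows "M \<star> (M * M) = (M * M) \<star> M"
proof -
  note M = brauer_loop_schemeD[OF assms]
  note car = cobullet_carrier[OF M(1) M(1)]
  show ?thesis
    using bullet_cobullet_assoc[OF M(1) M(1) M(1)] bullet_carrier[OF M(1) car] bullet_carrier[OF car M(1)]
    unfolding square_eq_cobullet[OF assms] M(2) bullet_zero[OF M(1)] by simp
qed

section \<open>Polynomial curves of matrices\<close>

definition poly_curve :: "nat \<Rightarrow> (complex \<Rightarrow> complex mat) \<Rightarrow> bool" where
  "poly_curve N F \<longleftrightarrow> (\<forall>s. F s \<in> carrier_mat N N) \<and>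
     (\<forall>i<N. \<forall>j<N. \<exists>p. \<forall>s. F s $$ (i, j) = poly p s)"

lemma poly_curve_carrier: "poly_curve N F \<Longrightarrow> F s \<in> carrier_mat N N"
  unfolding poly_curve_def by blast

lemma poly_curve_const: "M \<in> carrier_mat N N \<Longrightarrow> poly_curve N (\<lambda>_. M)"
  unfolding poly_curve_def by (auto intro: exI[of _ "[:_:]"])

lemma poly_curve_line:
  assumes "A \<in> carrier_mat N N" "B \<in> carrier_mat N N"
  shows "poly_curve N (\<lambda>s. A + s \<cdot>\<^sub>m (B - A))"
proof -
  have "(A + s \<cdot>\<^sub>m (B - A)) $$ (i, j) = poly [:A $$ (i, j), B $$ (i, j) - A $$ (i, j):] s"
    if "i < N" "j < N" for i j s
    using that assms by simp
  moreover have "A + s \<cdot>\<^sub>m (B - A) \<in> carrier_mat N N" for s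
    by (intro add_carrier_mat smult_carrier_mat minus_carrier_mat assms)
  ultimately show ?thesis
    unfolding poly_curve_def by meson
qed

text \<open>The predicate \<open>Z\<close> selects summands, so that one argument serves both the
  bullet product and the ordinary one.\<close>

lemma poly_curve_sum_mult:
  assumes "poly_curve N F" "poly_curve N G" "i < N" "k < N"
  shows "\<exists>p. \<forall>s. (\<Sum>j<N. if Z j then F s $$ (i, j) * G s $$ (j, k) else 0) = poly p s"
proof -
  have "\<exists>p q. \<forall>s. F s $$ (i, j) = poly p s \<and> G s $$ (j, k) = poly q s" if "j < N" for j
    using assms that unfolding poly_curve_def by meson
  then obtain p q where pq: "\<And>j s. j < N \<Longrightarrow> F s $$ (i, j) = poly (p j) s"
    "\<And>j s. j < N \<Longrightarrow> G s $$ (j, k) = poly (q j) s"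
    by metis
  show ?thesis
    by (rule exI[of _ "\<Sum>j<N. if Z j then p j * q j else 0"])
      (auto simp: poly_sum pq intro!: sum.cong)
qed

lemma poly_curve_bullet:
  assumes "poly_curve N F" "poly_curve N G"
  shows "poly_curve N (\<lambda>s. F s \<star> G s)"
  using poly_curve_sum_mult[OF assms, where Z = "\<lambda>j. cyc_ordered [_, j, _]"]
    poly_curve_carrier[OF assms(1)] poly_curve_carrier[OF assms(2)]
  unfolding poly_curve_def by (simp add: bullet_index[of _ N] bullet_carrier)

lemma poly_curve_times:
  assumes "poly_curve N F" "poly_curve N G"
  shows "poly_curve N (\<lambda>s. F s * G s)"
proof -
  have "(F s * G s) $$ (i, k) = (\<Sum>j<N. if True then F s $$ (i, j) * G s $$ (j, k) else 0)"
    if "i < N" "k < N" for i k s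
    using that poly_curve_carrier[OF assms(1), of s] poly_curve_carrier[OF assms(2), of s]
    by (auto simp: scalar_prod_def lessThan_atLeast0 intro!: sum.cong)
  then show ?thesis
    using poly_curve_sum_mult[OF assms, where Z = "\<lambda>_. True"]
      mult_carrier_mat[OF poly_curve_carrier[OF assms(1)] poly_curve_carrier[OF assms(2)]]
    unfolding poly_curve_def by simp
qed

text \<open>This pullback reduces questions about closure and irreducibility to the absence of zero
  divisors among polynomials in one variable.\<close>

lemma poly_funs_poly_curve:
  assumes "f \<in> poly_funs N" "poly_curve N F"
  shows "\<exists>p. \<forall>s. f (F s) = poly p s"
  using assms(1)
proof induction
  case (const c)
  then show ?case by (auto intro: exI[of _ "[:c:]"])
next
  case (entry i j)
  then show ?case using assms(2) unfolding poly_curve_def by blast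
next
  case (add f g)
  then show ?case by (metis poly_add)
next
  case (mult f g)
  then show ?case by (metis poly_mult)
qed

section \<open>The group U and its inverses along curves\<close>

lemma unit_diag_groupD:
  assumes "P \<in> unit_diag_group N"
  shows "P \<in> carrier_mat N N" "i < N \<Longrightarrow> P $$ (i, i) = 1"
  using assms by (auto simp: unit_diag_group_def)

lemma unit_diag_group_one: "1\<^sub>m N \<in> unit_diag_group N"
  by (auto simp: unit_diag_group_def)

lemma unit_diag_group_bullet:
  "P \<in> unit_diag_group N \<Longrightarrow> Q \<in> unit_diag_group N \<Longrightarrow> P \<star> Q \<in> unit_diag_group N"
  by (auto simp: unit_diag_group_def bullet_carrier bullet_diag)

text \<open>The approximate inverses come from the Newton iteration \<open>Q \<mapsto> Q \<star> (2 - P \<star> Q)\<close>; the family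
  version records that they depend polynomially on \<open>P\<close>.\<close>

lemma poly_curve_right_inverse:
  assumes P: "poly_curve N P" "\<And>s. P s \<in> unit_diag_group N"
  shows "\<exists>Q. poly_curve N Q \<and> (\<forall>s. Q s \<in> unit_diag_group N \<and> P s \<star> Q s = 1\<^sub>m N)"
proof -
  have "\<exists>Q. poly_curve N Q \<and> (\<forall>s. Q s \<in> unit_diag_group N \<and>
      (\<forall>i<N. \<forall>k<N. i \<noteq> k \<longrightarrow> cyc_dist N i k < h \<longrightarrow> (P s \<star> Q s) $$ (i, k) = 0))" for h
  proof (induction h)
    case 0
    show ?case
      by (rule exI[of _ "\<lambda>_. 1\<^sub>m N"]) (auto simp: poly_curve_const unit_diag_group_one)
  next
    case (Suc h)
    then obtain Q where Q: "poly_curve N Q" "\<And>s. Q s \<in> unit_diag_group N"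
      and *: "\<And>s i k. i < N \<Longrightarrow> k < N \<Longrightarrow> i \<noteq> k \<Longrightarrow> cyc_dist N i k < h \<Longrightarrow> (P s \<star> Q s) $$ (i, k) = 0"
      by blast
    define R where "R s = P s \<star> Q s" for s
    define Z where "Z s = mat N N (\<lambda>(i, k). (if i = k then 2 else 0) - R s $$ (i, k))" for s
    have R: "poly_curve N R" "R s \<in> unit_diag_group N" for s
      using poly_curve_bullet[OF P(1) Q(1)] unit_diag_group_bullet[OF P(2) Q(2)]
      unfolding R_def by auto
    note Rs = unit_diag_groupD[OF R(2)]
    have "\<exists>p. \<forall>s. Z s $$ (i, k) = poly p s" if ik: "i < N" "k < N" for i k
    proof -
      obtain p where "\<forall>s. R s $$ (i, k) = poly p s"
        using R(1) ik unfolding poly_curve_def by blast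
      then show ?thesis
        using ik by (intro exI[of _ "[:if i = k then 2 else 0:] - p"]) (auto simp: Z_def)
    qed
    then have Z: "poly_curve N Z" "Z s \<in> unit_diag_group N" for s
      using Rs by (auto simp: poly_curve_def unit_diag_group_def Z_def)
    note Zs = unit_diag_groupD[OF Z(2)]
    have "(P s \<star> (Q s \<star> Z s)) $$ (i, k) = 0"
      if "i < N" "k < N" "i \<noteq> k" "cyc_dist N i k < Suc h" for s i k
    proof -
      have "P s \<star> (Q s \<star> Z s) = R s \<star> Z s"
        unfolding R_def using bullet_assoc P Q Z poly_curve_carrier by metis
      \<comment> \<open>Off the diagonal \<open>R s\<close> vanishes at distances below
        \<open>h\<close>, so only the end terms survive. They are \<open>- R s $$ (i, k)\<close> and
        \<open>R s $$ (i, k)\<close>, which cancel.\<close>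
      moreover have "(R s \<star> Z s) $$ (i, k) = R s $$ (i, i) * Z s $$ (i, k) + R s $$ (i, k) * Z s $$ (k, k)"
        using that * by (intro bullet_index_ends[OF Rs(1) Zs(1)]) (auto simp: R_def)
      ultimately show ?thesis
        using that Rs Zs by (auto simp: Z_def)
    qed
    then show ?case
      using poly_curve_bullet[OF Q(1) Z(1)] unit_diag_group_bullet[OF Q(2) Z(2)]
      by (intro exI[of _ "\<lambda>s. Q s \<star> Z s"]) auto
  qed
  \<comment> \<open>At \<open>h = N\<close> the distance bound covers every off-diagonal
    entry.\<close>
  from this[of N] obtain Q where Q: "poly_curve N Q" "\<And>s. Q s \<in> unit_diag_group N"
    "\<And>s i k. i < N \<Longrightarrow> k < N \<Longrightarrow> i \<noteq> k \<Longrightarrow> cyc_dist N i k < N \<Longrightarrow> (P s \<star> Q s) $$ (i, k) = 0"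
    by blast
  have "P s \<star> Q s = 1\<^sub>m N" for s
  proof (rule eq_matI)
    note PQ = unit_diag_groupD[OF unit_diag_group_bullet[OF P(2)[of s] Q(2)[of s]]]
    show "dim_row (P s \<star> Q s) = dim_row (1\<^sub>m N)" "dim_col (P s \<star> Q s) = dim_col (1\<^sub>m N)"
      using PQ(1) by auto
    fix i k assume "i < dim_row (1\<^sub>m N :: complex mat)" "k < dim_col (1\<^sub>m N :: complex mat)"
    then show "(P s \<star> Q s) $$ (i, k) = 1\<^sub>m N $$ (i, k)"
      using PQ(2) Q(3) cyc_dist_less by (cases "i = k") simp_all
  qed
  with Q show ?thesis by blast
qed

lemma bullet_inv_eqI:
  assumes "P \<in> carrier_mat N N" "Q \<in> carrier_mat N N" "P \<star> Q = 1\<^sub>m N" "Q \<star> P = 1\<^sub>m N"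
  shows "bullet_inv N P = Q"
  unfolding bullet_inv_def
  using monoid.inv_unique'[OF monoid_bullet[of N], of P Q] assms by (simp add: bullet_monoid_def)

text \<open>The right inverse \<open>Q\<close> of \<open>P\<close> has itself a right inverse
  \<open>T\<close>. Associativity forces \<open>T = P\<close>, so \<open>Q\<close> is two-sided and
  equals \<open>bullet_inv\<close>.\<close>

lemma poly_curve_bullet_inv:
  assumes P: "poly_curve N P" "\<And>s. P s \<in> unit_diag_group N"
  shows "poly_curve N (\<lambda>s. bullet_inv N (P s))"
    and "bullet_inv N (P s) \<in> unit_diag_group N"
    and "P s \<star> bullet_inv N (P s) = 1\<^sub>m N" "bullet_inv N (P s) \<star> P s = 1\<^sub>m N"
proof -
  obtain Q where Q: "poly_curve N Q" "\<And>s. Q s \<in> unit_diag_group N" "\<And>s. P s \<star> Q s = 1\<^sub>m N"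
    using poly_curve_right_inverse[OF P] by blast
  obtain T where T: "poly_curve N T" "\<And>s. Q s \<star> T s = 1\<^sub>m N"
    using poly_curve_right_inverse[OF Q(1,2)] by blast
  note car = poly_curve_carrier[OF P(1)] poly_curve_carrier[OF Q(1)] poly_curve_carrier[OF T(1)]
  have "P s = T s" for s
    using bullet_assoc[OF car, of s s s] Q(3) T(2) bullet_one[OF car(1)] bullet_one[OF car(3)] by metis
  then have QP: "Q s \<star> P s = 1\<^sub>m N" for s
    using T(2) by metis
  have "bullet_inv N (P s) = Q s" for s
    using bullet_inv_eqI[OF car(1,2)] Q(3) QP by blast
  then show "poly_curve N (\<lambda>s. bullet_inv N (P s))" "bullet_inv N (P s) \<in> unit_diag_group N"
    "P s \<star> bullet_inv N (P s) = 1\<^sub>m N" "bullet_inv N (P s) \<star> P s = 1\<^sub>m N"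
    using Q QP by auto
qed

lemma bullet_inv_unit_diag:
  assumes "P \<in> unit_diag_group N"
  shows "bullet_inv N P \<in> unit_diag_group N"
    "P \<star> bullet_inv N P = 1\<^sub>m N" "bullet_inv N P \<star> P = 1\<^sub>m N"
  \<comment> \<open>A single \<open>P\<close> is treated as a constant curve.\<close>
  using poly_curve_bullet_inv[OF poly_curve_const[OF unit_diag_groupD(1)[OF assms]]] assms by auto

section \<open>Bullet conjugation by U\<close>

lemma bullet_conj_carrier:
  assumes "P \<in> unit_diag_group N" "M \<in> carrier_mat N N"
  shows "P \<star> M \<star> bullet_inv N P \<in> carrier_mat N N"
  using assms bullet_inv_unit_diag(1)[OF assms(1)] by (auto simp: unit_diag_group_def bullet_carrier)

text \<open>Conjugates are mostly handled through this intertwining relation, whose entries can be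
  compared without knowing those of the inverse.\<close>

lemma bullet_conj_bullet:
  assumes P: "P \<in> unit_diag_group N" and M: "M \<in> carrier_mat N N"
  shows "P \<star> M \<star> bullet_inv N P \<star> P = P \<star> M"
proof -
  note I = bullet_inv_unit_diag[OF P]
  note car = unit_diag_groupD(1)[OF P] unit_diag_groupD(1)[OF I(1)]
  show ?thesis
    using bullet_assoc[OF bullet_carrier[OF car(1) M] car(2) car(1)] I(3)
      bullet_one[OF bullet_carrier[OF car(1) M]] by simp
qed

lemma bullet_conj_inverse:
  assumes P: "P \<in> unit_diag_group N" and M: "M \<in> carrier_mat N N" and R: "R \<in> carrier_mat N N"
    and eq: "R \<star> P = P \<star> M"
  shows "M = bullet_inv N P \<star> R \<star> P"
proof -
  note I = bullet_inv_unit_diag[OF P]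
  note car = unit_diag_groupD(1)[OF P] unit_diag_groupD(1)[OF I(1)]
  show "M = bullet_inv N P \<star> R \<star> P"
    using bullet_assoc[OF car(2) R car(1)] bullet_assoc[OF car(2) car(1) M] bullet_one[OF M] I(3) eq
    by metis
qed

text \<open>On the scheme the ordinary square is \<open>M \<diamond> M\<close>, and the mixed
  associativity law moves \<open>P\<close> across \<diamond>. This is why the diagonal of the square
  is invariant under a conjugation defined by another product.\<close>

lemma brauer_loop_scheme_conj:
  assumes P: "P \<in> unit_diag_group N" and M: "M \<in> brauer_loop_scheme N"
  defines "M' \<equiv> P \<star> M \<star> bullet_inv N P"
  shows "M' \<in> brauer_loop_scheme N"
    and "i < N \<Longrightarrow> (M' * M') $$ (i, i) = (M * M) $$ (i, i)"
proof -
  note M = M brauer_loop_schemeD[OF M]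
  note I = bullet_inv_unit_diag[OF P]
  note p = unit_diag_groupD(1)[OF P] and q = unit_diag_groupD(1)[OF I(1)]
  have m': "M' \<in> carrier_mat N N"
    unfolding M'_def using bullet_conj_carrier[OF P M(2)] .
  have eq: "M' \<star> P = P \<star> M"
    unfolding M'_def by (rule bullet_conj_bullet[OF P M(2)])
  have "M' \<star> M' = M' \<star> P \<star> M \<star> bullet_inv N P"
    using bullet_assoc[OF m' bullet_carrier[OF p M(2)] q] bullet_assoc[OF m' p M(2)] M'_def by metis
  also have "M' \<star> P \<star> M = 0\<^sub>m N N"
    unfolding eq using bullet_assoc[OF p M(2) M(2)] M(3) bullet_zero[OF p] by simp
  finally have sq: "M' \<star> M' = 0\<^sub>m N N"
    using bullet_zero[OF q] by simp
  have diag: "M' $$ (i, i) = 0" if "i < N" for i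
    unfolding M'_def using that M(4) bullet_diag[OF bullet_carrier[OF p M(2)] q that] bullet_diag[OF p M(2) that]
    by simp
  show M': "M' \<in> brauer_loop_scheme N"
    using m' sq diag by (auto simp: brauer_loop_scheme_def)
  assume i: "i < N"
  \<comment> \<open>On the diagonal \<star> is plain multiplication of entries, so the mixed law
    becomes a scalar identity.\<close>
  have assoc: "A $$ (i, i) * (B \<diamond> C) $$ (i, i) + (A \<diamond> (B \<star> C)) $$ (i, i) =
      (A \<diamond> B) $$ (i, i) * C $$ (i, i) + ((A \<star> B) \<diamond> C) $$ (i, i)"
    if A: "A \<in> carrier_mat N N" and B: "B \<in> carrier_mat N N" and C: "C \<in> carrier_mat N N" for A B C
  proof -
    note car = bullet_carrier[OF A B] bullet_carrier[OF B C] cobullet_carrier[OF A B] cobullet_carrier[OF B C]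
    show ?thesis
      using arg_cong[OF bullet_cobullet_assoc[OF A B C], of "\<lambda>X. X $$ (i, i)"] i
        cobullet_carrier[OF A car(2)] cobullet_carrier[OF car(1) C]
        bullet_carrier[OF A car(4)] bullet_carrier[OF car(3) C]
      by (simp add: bullet_diag[OF A car(4) i] bullet_diag[OF car(3) C i])
  qed
  \<comment> \<open>The scalar identity is applied to the triples \<open>M', M', P\<close>, then
    \<open>M', P, M\<close>, then \<open>P, M, M\<close>. They are linked by
    \<open>M' \<star> P = P \<star> M\<close>, and the zero diagonals of \<open>M\<close> and
    \<open>M'\<close> remove the other terms.\<close>
  have "(M' \<diamond> M') $$ (i, i) = (M' \<diamond> (M' \<star> P)) $$ (i, i)"
    using assoc[OF m' m' p] i diag unit_diag_groupD[OF P] by (simp add: sq bullet_zero[OF p])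
  also have "\<dots> = ((M' \<star> P) \<diamond> M) $$ (i, i)"
    using assoc[OF m' p M(2)] i diag M(4) by (simp add: eq)
  also have "\<dots> = (M \<diamond> M) $$ (i, i)"
    using assoc[OF p M(2) M(2)] i M(4) unit_diag_groupD[OF P] by (simp add: eq M(3) bullet_zero[OF p])
  finally show "(M' * M') $$ (i, i) = (M * M) $$ (i, i)"
    using square_eq_cobullet M' M(1) by simp
qed

section \<open>Block-diagonalisation along the pairs of \<open>\<pi>\<close>\<close>

text \<open>As for triangular matrices, an entry lying between two different diagonal values can be
  conjugated away. Each round clears the unwanted entries at one distance \<open>h\<close> and keeps
  the zeros at shorter distances.\<close>

lemma bullet_conj_block_diagonal:
  assumes Q: "Q \<in> carrier_mat N N"
    and dist: "\<And>i k. i < N \<Longrightarrow> k < N \<Longrightarrow> i \<noteq> k \<Longrightarrow> k \<noteq> \<pi> i \<Longrightarrow> Q $$ (i, i) \<noteq> Q $$ (k, k)"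
  shows "\<exists>P \<in> unit_diag_group N. \<exists>R \<in> carrier_mat N N. R \<star> P = P \<star> Q \<and>
    (\<forall>i<N. R $$ (i, i) = Q $$ (i, i)) \<and> (\<forall>i<N. \<forall>k<N. i \<noteq> k \<longrightarrow> k \<noteq> \<pi> i \<longrightarrow> R $$ (i, k) = 0)"
proof -
  have "\<exists>P \<in> unit_diag_group N. \<exists>R \<in> carrier_mat N N. R \<star> P = P \<star> Q \<and>
    (\<forall>i<N. R $$ (i, i) = Q $$ (i, i)) \<and>
    (\<forall>i<N. \<forall>k<N. i \<noteq> k \<longrightarrow> k \<noteq> \<pi> i \<longrightarrow> cyc_dist N i k < h \<longrightarrow> R $$ (i, k) = 0)" for h
  proof (induction h)
    case 0
    show ?case
      using Q bullet_one by (intro bexI[of _ "1\<^sub>m N"] bexI[of _ Q]) (auto simp: unit_diag_group_one)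
  next
    case (Suc h)
    then obtain P R where P: "P \<in> unit_diag_group N" and R: "R \<in> carrier_mat N N"
      and eq: "R \<star> P = P \<star> Q" and d: "\<And>i. i < N \<Longrightarrow> R $$ (i, i) = Q $$ (i, i)"
      and z: "\<And>i k. i < N \<Longrightarrow> k < N \<Longrightarrow> i \<noteq> k \<Longrightarrow> k \<noteq> \<pi> i \<Longrightarrow> cyc_dist N i k < h \<Longrightarrow> R $$ (i, k) = 0"
      by blast
    \<comment> \<open>The off-diagonal entry solves
      \<open>R $$ (i, k) = X $$ (i, k) * (R $$ (i, i) - R $$ (k, k))\<close>, the condition for the
      conjugated entry to vanish. The denominator is nonzero by \<open>dist\<close> and
      \<open>d\<close>.\<close>
    define X where "X = mat N N (\<lambda>(i, k). if i = k then 1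
      else if cyc_dist N i k = h \<and> k \<noteq> \<pi> i then R $$ (i, k) / (R $$ (i, i) - R $$ (k, k)) else 0)"
    have X: "X \<in> unit_diag_group N"
      by (auto simp: X_def unit_diag_group_def)
    define R' where "R' = X \<star> R \<star> bullet_inv N X"
    have R': "R' \<in> carrier_mat N N"
      unfolding R'_def by (rule bullet_conj_carrier[OF X R])
    note p = unit_diag_groupD(1)[OF P] and x = unit_diag_groupD(1)[OF X]
    have eq': "R' \<star> X = X \<star> R"
      unfolding R'_def by (rule bullet_conj_bullet[OF X R])
    have "R' \<star> (X \<star> P) = (X \<star> P) \<star> Q"
      using bullet_assoc[OF R' x p] bullet_assoc[OF x R p] bullet_assoc[OF x p Q] eq eq' by simp
    moreover have d': "R' $$ (i, i) = R $$ (i, i)" if "i < N" for i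
      using arg_cong[OF eq', of "\<lambda>M. M $$ (i, i)"] bullet_diag[OF R' x that] bullet_diag[OF x R that]
        unit_diag_groupD(2)[OF X that] by simp
    moreover have "R' $$ (i, k) = 0"
      if ik: "i < N" "k < N" "i \<noteq> k" "k \<noteq> \<pi> i" "cyc_dist N i k < Suc h" for i k
    proof -
      have low: "X $$ (i, k) = 0" if "i < N" "k < N" "i \<noteq> k" "cyc_dist N i k < h" for i k
        using that by (auto simp: X_def)
      have "R' $$ (i, i) * X $$ (i, k) + R' $$ (i, k) * X $$ (k, k) = (R' \<star> X) $$ (i, k)"
        using ik low by (intro bullet_index_ends[OF R' x, symmetric]) auto
      also have "\<dots> = X $$ (i, i) * R $$ (i, k) + X $$ (i, k) * R $$ (k, k)"
        unfolding eq' using ik low by (intro bullet_index_ends[OF x R]) auto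
      finally have "R' $$ (i, k) = R $$ (i, k) - X $$ (i, k) * (R $$ (i, i) - R $$ (k, k))"
        using ik d' unit_diag_groupD(2)[OF X] by (simp add: algebra_simps)
      then show ?thesis
        using ik z[of i k] low[of i k] dist[of i k] d by (cases "cyc_dist N i k = h") (auto simp: X_def)
    qed
    ultimately show ?case
      using d by (intro bexI[OF _ unit_diag_group_bullet[OF X P]] bexI[OF _ R'] conjI allI impI) simp_all
  qed
  from this[of N] show ?thesis
    by (simp add: cyc_dist_less cong: imp_cong conj_cong)
qed

text \<open>By induction on the distance, an inner summand can be nonzero only if
  \<open>j = \<pi> i\<close> and \<open>k = \<pi> j\<close>, which forces \<open>k = i\<close>.
  Comparing the two products then leaves \<open>M $$ (i, k)\<close> times a nonzero difference of
  diagonal entries of \<open>R\<close>.\<close>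

lemma bullet_commute_block_diagonal:
  assumes M: "M \<in> carrier_mat N N" and R: "R \<in> carrier_mat N N" and comm: "M \<star> R = R \<star> M"
    and dist: "\<And>i k. i < N \<Longrightarrow> k < N \<Longrightarrow> i \<noteq> k \<Longrightarrow> k \<noteq> \<pi> i \<Longrightarrow> R $$ (i, i) \<noteq> R $$ (k, k)"
    and off: "\<And>i k. i < N \<Longrightarrow> k < N \<Longrightarrow> i \<noteq> k \<Longrightarrow> k \<noteq> \<pi> i \<Longrightarrow> R $$ (i, k) = 0"
    and invol: "\<And>i. i < N \<Longrightarrow> \<pi> (\<pi> i) = i"
    and ik: "i < N" "k < N" "i \<noteq> k" "k \<noteq> \<pi> i"
  shows "M $$ (i, k) = 0"
  using ik
proof (induction "cyc_dist N i k" arbitrary: i k rule: less_induct)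
  case less
  have 1: "M $$ (i, j) = 0 \<or> R $$ (j, k) = 0" "R $$ (i, j) = 0 \<or> M $$ (j, k) = 0"
    if "j < N" "j \<noteq> i" "j \<noteq> k" "cyc_dist N i j < cyc_dist N i k" "cyc_dist N j k < cyc_dist N i k" for j
    using that less off invol by metis+
  have "M $$ (i, i) * R $$ (i, k) + M $$ (i, k) * R $$ (k, k) = (M \<star> R) $$ (i, k)"
    using less.prems 1(1) by (intro bullet_index_ends[OF M R, symmetric]) auto
  also have "\<dots> = R $$ (i, i) * M $$ (i, k) + R $$ (i, k) * M $$ (k, k)"
    unfolding comm using less.prems 1(2) by (intro bullet_index_ends[OF R M]) auto
  finally have "M $$ (i, k) * (R $$ (k, k) - R $$ (i, i)) = 0"
    using off less.prems by (simp add: algebra_simps)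
  then show ?case
    using dist less.prems by fastforce
qed

section \<open>The matrices \<open>underline_perm N \<pi> * t\<close>\<close>

lemma underline_perm_times_index:
  assumes "t \<in> carrier_mat N N" "diagonal_mat t" "i < N" "j < N"
  shows "(underline_perm N \<pi> * t) $$ (i, j) = (if i = \<pi> j \<and> i \<noteq> j then t $$ (j, j) else 0)"
proof -
  have "(underline_perm N \<pi> * t) $$ (i, j) =
      (\<Sum>k<N. (if i = \<pi> k \<and> i \<noteq> k then 1 else 0) * t $$ (k, j))"
    using assms by (auto simp: underline_perm_def scalar_prod_def lessThan_atLeast0 intro!: sum.cong)
  also have "\<dots> = (\<Sum>k<N. if k = j then (if i = \<pi> j \<and> i \<noteq> j then t $$ (j, j) else 0) else 0)"
    using assms by (intro sum.cong) (auto simp: diagonal_mat_def)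
  finally show ?thesis
    using assms by simp
qed

lemma underline_perm_times_carrier:
  "t \<in> carrier_mat N N \<Longrightarrow> underline_perm N \<pi> * t \<in> carrier_mat N N"
  by (auto simp: underline_perm_def)

lemma link_patternD:
  assumes "link_pattern N r \<pi>"
  shows "i < N \<Longrightarrow> \<pi> i < N" "i < N \<Longrightarrow> \<pi> (\<pi> i) = i"
  using assms permutes_in_image[of \<pi> "{..<N}" i] by (auto simp: link_pattern_def)

text \<open>The only two-step paths that contribute run from \<open>i\<close> to
  \<open>\<pi> i\<close> and back. With equal ends and a different middle they are not cyclically
  ordered, so the ordinary square sees them and the bullet square does not.\<close>

lemma underline_perm_times_brauer:
  assumes lp: "link_pattern N r \<pi>" and t: "t \<in> carrier_mat N N" "diagonal_mat t"
  defines "M \<equiv> underline_perm N \<pi> * t"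
  shows "M \<in> brauer_loop_scheme N"
    and "i < N \<Longrightarrow> (M * M) $$ (i, i) = (if \<pi> i = i then 0 else t $$ (i, i) * t $$ (\<pi> i, \<pi> i))"
proof -
  note pi = link_patternD[OF lp]
  have M: "M \<in> carrier_mat N N"
    unfolding M_def by (rule underline_perm_times_carrier[OF t(1)])
  have idx: "M $$ (i, j) = (if i = \<pi> j \<and> i \<noteq> j then t $$ (j, j) else 0)" if "i < N" "j < N" for i j
    unfolding M_def by (rule underline_perm_times_index[OF t that])
  have "(M \<star> M) $$ (i, k) = 0" if "i < N" "k < N" for i k
    unfolding bullet_index[OF M M that] using that idx pi
    by (intro sum.neutral) (auto simp: cyc_ordered3_iff)
  then have "M \<star> M = 0\<^sub>m N N"
    using bullet_carrier[OF M M] by (intro eq_matI) auto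
  then show "M \<in> brauer_loop_scheme N"
    using M idx by (auto simp: brauer_loop_scheme_def)
  assume i: "i < N"
  have "(M * M) $$ (i, i) = (\<Sum>j<N. M $$ (i, j) * M $$ (j, i))"
    using M i by (auto simp: scalar_prod_def lessThan_atLeast0 intro!: sum.cong)
  also have "\<dots> = (\<Sum>j<N. if j = \<pi> i then (if \<pi> i = i then 0 else t $$ (i, i) * t $$ (\<pi> i, \<pi> i)) else 0)"
    using i pi by (intro sum.cong) (auto simp: idx)
  finally show "(M * M) $$ (i, i) = (if \<pi> i = i then 0 else t $$ (i, i) * t $$ (\<pi> i, \<pi> i))"
    using pi i by simp
qed

section \<open>Generic points of the component lie in the orbit\<close>

definition generic_part :: "nat \<Rightarrow> (nat \<Rightarrow> nat) \<Rightarrow> complex mat set" where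
  "generic_part N \<pi> = {M \<in> brauer_loop_scheme N.
     \<forall>i<N. \<forall>j<N. (M * M) $$ (i, i) = (M * M) $$ (j, j) \<longleftrightarrow> j \<in> {i, \<pi> i}}"

abbreviation pattern_orbit :: "nat \<Rightarrow> (nat \<Rightarrow> nat) \<Rightarrow> complex mat set" where
  "pattern_orbit N \<pi> \<equiv>
     bullet_orbit N {underline_perm N \<pi> * t | t. t \<in> carrier_mat N N \<and> diagonal_mat t}"

lemma pattern_orbit_iff:
  "M \<in> pattern_orbit N \<pi> \<longleftrightarrow> (\<exists>P t. P \<in> unit_diag_group N \<and> t \<in> carrier_mat N N \<and> diagonal_mat t \<and>
     M = P \<star> (underline_perm N \<pi> * t) \<star> bullet_inv N P)"
  unfolding bullet_orbit_def by blast

lemma pattern_orbit_carrier: "pattern_orbit N \<pi> \<subseteq> carrier_mat N N"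
  using bullet_conj_carrier underline_perm_times_carrier by (auto simp: pattern_orbit_iff)

lemma generic_part_subset_orbit:
  assumes lp: "link_pattern N r \<pi>"
  shows "generic_part N \<pi> \<subseteq> pattern_orbit N \<pi>"
proof
  fix M assume "M \<in> generic_part N \<pi>"
  then have ME: "M \<in> brauer_loop_scheme N"
    and gen: "\<And>i j. i < N \<Longrightarrow> j < N \<Longrightarrow> (M * M) $$ (i, i) = (M * M) $$ (j, j) \<longleftrightarrow> j \<in> {i, \<pi> i}"
    by (auto simp: generic_part_def)
  note pi = link_patternD[OF lp]
  note M = brauer_loop_schemeD[OF ME]
  have Q: "M * M \<in> carrier_mat N N"
    using M(1) M(1) by (rule mult_carrier_mat)
  have dist: "(M * M) $$ (i, i) \<noteq> (M * M) $$ (k, k)" if "i < N" "k < N" "i \<noteq> k" "k \<noteq> \<pi> i" for i k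
    using gen[OF that(1,2)] that(3,4) by blast
  obtain P R where P: "P \<in> unit_diag_group N" and R: "R \<in> carrier_mat N N" and eq: "R \<star> P = P \<star> (M * M)"
    and d: "\<And>i. i < N \<Longrightarrow> R $$ (i, i) = (M * M) $$ (i, i)"
    and off: "\<And>i k. i < N \<Longrightarrow> k < N \<Longrightarrow> i \<noteq> k \<Longrightarrow> k \<noteq> \<pi> i \<Longrightarrow> R $$ (i, k) = 0"
    using bullet_conj_block_diagonal[OF Q, of \<pi>] dist by blast
  define M' where "M' = P \<star> M \<star> bullet_inv N P"
  note I = bullet_inv_unit_diag[OF P]
  note p = unit_diag_groupD(1)[OF P] and q = unit_diag_groupD(1)[OF I(1)]
  have M': "M' \<in> brauer_loop_scheme N"
    unfolding M'_def by (rule brauer_loop_scheme_conj(1)[OF P ME])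
  note m' = brauer_loop_schemeD[OF M']
  have eqM: "M' \<star> P = P \<star> M"
    unfolding M'_def by (rule bullet_conj_bullet[OF P M(1)])
  \<comment> \<open>\<open>M\<close> commutes with its ordinary square, and conjugation by
    \<open>P\<close> carries this to \<open>M'\<close> and \<open>R\<close>. The right factor
    \<open>P\<close> is cancelled at the end by its inverse.\<close>
  have comm: "M' \<star> R = R \<star> M'"
  proof -
    have "M' \<star> R \<star> P = P \<star> M \<star> (M * M)"
      using bullet_assoc[OF m'(1) R p] bullet_assoc[OF m'(1) p Q] eq eqM by simp
    also have "\<dots> = P \<star> (M * M) \<star> M"
      using bullet_assoc[OF p M(1) Q] bullet_assoc[OF p Q M(1)] bullet_square_commute[OF ME] by simp
    also have "\<dots> = R \<star> M' \<star> P"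
      using bullet_assoc[OF R m'(1) p] bullet_assoc[OF R p M(1)] eq eqM by simp
    finally show ?thesis
      using bullet_assoc[OF bullet_carrier[OF m'(1) R] p q] bullet_assoc[OF bullet_carrier[OF R m'(1)] p q]
        I(2) bullet_one[OF bullet_carrier[OF m'(1) R]] bullet_one[OF bullet_carrier[OF R m'(1)]] by metis
  qed
  have zero: "M' $$ (i, k) = 0" if "i < N" "k < N" "i \<noteq> k" "k \<noteq> \<pi> i" for i k
    using that d gen by (intro bullet_commute_block_diagonal[OF m'(1) R comm _ off pi(2)]) auto
  \<comment> \<open>Column \<open>j\<close> of \<open>M'\<close> has at most one nonzero entry, in
    row \<open>\<pi> j\<close>, and \<open>t\<close> records it. At a fixed point this is the
    diagonal entry of \<open>M'\<close>, which is zero.\<close>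
  define t where "t = mat N N (\<lambda>(i, j). if i = j then M' $$ (\<pi> j, j) else 0)"
  have t: "t \<in> carrier_mat N N" "diagonal_mat t"
    by (auto simp: t_def diagonal_mat_def)
  have "M' = underline_perm N \<pi> * t"
  proof (rule eq_matI)
    fix i j assume "i < dim_row (underline_perm N \<pi> * t)" "j < dim_col (underline_perm N \<pi> * t)"
    then have ij: "i < N" "j < N"
      using underline_perm_times_carrier[OF t(1), of \<pi>] by auto
    show "M' $$ (i, j) = (underline_perm N \<pi> * t) $$ (i, j)"
    proof (cases "i = \<pi> j \<and> i \<noteq> j")
      case True
      then show ?thesis
        unfolding underline_perm_times_index[OF t ij] using ij by (simp add: t_def)
    next
      case False
      moreover have "j = \<pi> i \<Longrightarrow> i = \<pi> j"
        using pi(2)[OF ij(1)] by simp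
      ultimately have "M' $$ (i, j) = 0"
        using zero[OF ij] m'(3)[OF ij(1)] by metis
      then show ?thesis
        unfolding underline_perm_times_index[OF t ij] using False by auto
    qed
  qed (use m'(1) underline_perm_times_carrier[OF t(1), of \<pi>] in auto)
  \<comment> \<open>Conjugation by \<open>P\<close> leads from \<open>M\<close> to
    \<open>M'\<close>, while membership in the orbit needs the opposite direction. The group element
    is therefore \<open>bullet_inv N P\<close>.\<close>
  moreover have "bullet_inv N (bullet_inv N P) = P"
    using bullet_inv_eqI[OF q p I(3,2)] .
  ultimately have "M = bullet_inv N P \<star> (underline_perm N \<pi> * t) \<star> bullet_inv N (bullet_inv N P)"
    using bullet_conj_inverse[OF P M(1) m'(1) eqM] by simp
  then show "M \<in> pattern_orbit N \<pi>"
    using I(1) t unfolding pattern_orbit_iff by blast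
qed

section \<open>The orbit lies in the closure of the generic part\<close>

text \<open>Every open neighbourhood of \<open>M\<close> contains a set \<open>f \<noteq> 0\<close>
  around \<open>M\<close>, so adherence can be tested on single polynomials.\<close>

lemma closure_of_zariskiI:
  assumes "M \<in> carrier_mat N N" "\<And>f. f \<in> poly_funs N \<Longrightarrow> (\<And>X. X \<in> T \<inter> carrier_mat N N \<Longrightarrow> f X = 0) \<Longrightarrow> f M = 0"
  shows "M \<in> zariski N closure_of T"
  unfolding closure_of_def
proof (intro CollectI conjI allI impI)
  show "M \<in> topspace (zariski N)"
    using assms(1) by (simp add: topspace_zariski)
  fix V assume "M \<in> V \<and> openin (zariski N) V"
  then obtain F where F: "F \<subseteq> poly_funs N" "V = carrier_mat N N - zero_locus N F" "M \<in> V"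
    by (auto simp: openin_zariski)
  then obtain f where "f \<in> F" "f M \<noteq> 0"
    by (auto simp: zero_locus_def)
  then obtain X where "X \<in> T \<inter> carrier_mat N N" "f X \<noteq> 0"
    using assms(2) F(1) by blast
  then show "\<exists>y\<in>T. y \<in> V"
    using F(2) \<open>f \<in> F\<close> by (auto simp: zero_locus_def)
qed

lemma diagonal_line:
  fixes t u :: "complex mat"
  assumes "t \<in> carrier_mat N N" "diagonal_mat t" "u \<in> carrier_mat N N" "diagonal_mat u"
  shows "t + s \<cdot>\<^sub>m (u - t) \<in> carrier_mat N N" "diagonal_mat (t + s \<cdot>\<^sub>m (u - t))"
proof -
  show "t + s \<cdot>\<^sub>m (u - t) \<in> carrier_mat N N"
    by (intro add_carrier_mat smult_carrier_mat minus_carrier_mat assms)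
  show "diagonal_mat (t + s \<cdot>\<^sub>m (u - t))"
    using assms by (auto simp: diagonal_mat_def)
qed

lemma line_ends:
  fixes A B :: "complex mat"
  assumes "A \<in> carrier_mat N N" "B \<in> carrier_mat N N"
  shows "A + 0 \<cdot>\<^sub>m (B - A) = A" "A + 1 \<cdot>\<^sub>m (B - A) = B"
  using assms by (auto intro!: eq_matI)

lemma poly_curve_pattern:
  assumes "poly_curve N T"
  shows "poly_curve N (\<lambda>s. underline_perm N \<pi> * T s)"
  using poly_curve_times[OF poly_curve_const assms] by (auto simp: underline_perm_def)

lemma exists_generic_diagonal:
  assumes "link_pattern N r \<pi>" "r \<in> {0, 1}"
  shows "\<exists>u. u \<in> carrier_mat N N \<and> diagonal_mat u \<and> underline_perm N \<pi> * u \<in> generic_part N \<pi>"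
proof -
  note pi = link_patternD[OF assms(1)]
  \<comment> \<open>\<open>Suc (min i (\<pi> i))\<close> is constant on each pair and separates the
    pairs. \<open>Suc\<close> keeps it nonzero on the pair containing index 0, so its square differs
    from the value 0 at a fixed point.\<close>
  define u :: "complex mat" where "u = mat N N (\<lambda>(i, j). if i = j then of_nat (Suc (min i (\<pi> i))) else 0)"
  have u: "u \<in> carrier_mat N N" "diagonal_mat u"
    by (auto simp: u_def diagonal_mat_def)
  define c where "c i = (if \<pi> i = i then 0 else Suc (min i (\<pi> i)) * Suc (min i (\<pi> i)))" for i
  have sq: "((underline_perm N \<pi> * u) * (underline_perm N \<pi> * u)) $$ (i, i) = of_nat (c i)" if "i < N" for i
    using that underline_perm_times_brauer(2)[OF assms(1) u that] pi
    by (auto simp: u_def c_def min.commute algebra_simps)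
  \<comment> \<open>The bound on \<open>r\<close> enters here: two fixed points would share the
    value 0 without forming a pair.\<close>
  have fix1: "i = j" if "i < N" "j < N" "\<pi> i = i" "\<pi> j = j" for i j
  proof -
    have "card {i. i < N \<and> \<pi> i = i} = r"
      using assms(1) unfolding link_pattern_def by blast
    moreover have "r \<le> Suc 0"
      using assms(2) by auto
    ultimately have "card {i. i < N \<and> \<pi> i = i} \<le> Suc 0"
      by (simp only:)
    moreover have "finite {i. i < N \<and> \<pi> i = i}"
      by simp
    ultimately have "\<forall>x\<in>{i. i < N \<and> \<pi> i = i}. \<forall>y\<in>{i. i < N \<and> \<pi> i = i}. x = y"
      using card_le_Suc0_iff_eq by blast
    then show ?thesis
      using that by blast
  qed
  have "c i = c j \<longleftrightarrow> j \<in> {i, \<pi> i}" if ij: "i < N" "j < N" for i j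
  proof
    assume eq: "c i = c j"
    show "j \<in> {i, \<pi> i}"
    proof (cases "\<pi> i = i \<or> \<pi> j = j")
      case True
      then show ?thesis
        using eq fix1 ij by (auto simp: c_def split: if_splits)
    next
      case False
      then have "(Suc (min i (\<pi> i)))\<^sup>2 = (Suc (min j (\<pi> j)))\<^sup>2"
        using eq unfolding c_def power2_eq_square by simp
      then have "min i (\<pi> i) = min j (\<pi> j)"
        using power2_eq_imp_eq[of "Suc (min i (\<pi> i))" "Suc (min j (\<pi> j))"] by simp
      then have "i = j \<or> i = \<pi> j \<or> \<pi> i = j \<or> \<pi> i = \<pi> j"
        by (simp add: min_def split: if_splits)
      then show ?thesis
        using pi(2)[OF ij(1)] pi(2)[OF ij(2)] by (metis insertCI)
    qed
  next
    assume "j \<in> {i, \<pi> i}"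
    then show "c i = c j"
      using pi ij by (auto simp: c_def min.commute)
  qed
  then have "underline_perm N \<pi> * u \<in> generic_part N \<pi>"
    using sq underline_perm_times_brauer(1)[OF assms(1) u] by (auto simp: generic_part_def)
  with u show ?thesis by blast
qed

text \<open>With \<open>P\<close> fixed, \<open>t\<close> moves along a line towards a generic
  \<open>u\<close>. The non-generic parameters are among the roots of a nonzero polynomial, so a
  polynomial function vanishing on the generic part vanishes along the whole curve, including its
  start.\<close>

lemma pattern_orbit_subset_closure:
  assumes lp: "link_pattern N r \<pi>" "r \<in> {0, 1}"
  shows "pattern_orbit N \<pi> \<subseteq> zariski N closure_of generic_part N \<pi>"
proof
  fix M assume "M \<in> pattern_orbit N \<pi>"
  then obtain P t where P: "P \<in> unit_diag_group N" and t: "t \<in> carrier_mat N N" "diagonal_mat t"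
    and M: "M = P \<star> (underline_perm N \<pi> * t) \<star> bullet_inv N P"
    by (auto simp: pattern_orbit_iff)
  obtain u where u: "u \<in> carrier_mat N N" "diagonal_mat u" and gu: "underline_perm N \<pi> * u \<in> generic_part N \<pi>"
    using exists_generic_diagonal[OF lp] by blast
  note pi = link_patternD[OF lp(1)]
  define W where "W s = underline_perm N \<pi> * (t + s \<cdot>\<^sub>m (u - t))" for s
  define Y where "Y s = P \<star> W s \<star> bullet_inv N P" for s
  have W: "poly_curve N W"
    unfolding W_def by (rule poly_curve_pattern[OF poly_curve_line[OF t(1) u(1)]])
  have WE: "W s \<in> brauer_loop_scheme N" for s
    unfolding W_def by (rule underline_perm_times_brauer(1)[OF lp(1) diagonal_line[OF t u]])
  have W0: "W 0 = underline_perm N \<pi> * t" and W1: "W 1 = underline_perm N \<pi> * u"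
    unfolding W_def line_ends[OF t(1) u(1)] by simp_all
  note p = unit_diag_groupD(1)[OF P] and q = unit_diag_groupD(1)[OF bullet_inv_unit_diag(1)[OF P]]
  have Y: "poly_curve N Y"
    unfolding Y_def by (intro poly_curve_bullet poly_curve_const W p q)
  have YE: "Y s \<in> brauer_loop_scheme N" "\<And>i. i < N \<Longrightarrow> (Y s * Y s) $$ (i, i) = (W s * W s) $$ (i, i)" for s
    unfolding Y_def using brauer_loop_scheme_conj[OF P WE] by auto
  have "\<exists>p. p \<noteq> 0 \<and> (\<forall>s. poly p s \<noteq> 0 \<longrightarrow> (W s * W s) $$ (i, i) \<noteq> (W s * W s) $$ (j, j))"
    if "i < N" "j < N" "j \<notin> {i, \<pi> i}" for i j
  proof -
    have "\<exists>p. \<forall>s. (W s * W s) $$ (i, i) - (W s * W s) $$ (j, j) = poly p s"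
      using poly_curve_times[OF W W] that unfolding poly_curve_def by (metis poly_diff)
    then obtain p where pp: "\<And>s. (W s * W s) $$ (i, i) - (W s * W s) $$ (j, j) = poly p s"
      by blast
    have "(W 1 * W 1) $$ (i, i) \<noteq> (W 1 * W 1) $$ (j, j)"
      using gu that unfolding generic_part_def W1 by blast
    then have "poly p 1 \<noteq> 0"
      unfolding pp[symmetric] by simp
    then show ?thesis
      using pp by (intro exI[of _ p]) (metis poly_0 right_minus_eq)
  qed
  \<comment> \<open>The constant polynomial 1 is the default outside the relevant pairs, so that
    \<open>g\<close> is nonzero everywhere and can be multiplied over all \<open>i\<close> and
    \<open>j\<close>.\<close>
  then have "\<exists>p. p \<noteq> 0 \<and> (i < N \<longrightarrow> j < N \<longrightarrow> j \<notin> {i, \<pi> i} \<longrightarrow>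
      (\<forall>s. poly p s \<noteq> 0 \<longrightarrow> (W s * W s) $$ (i, i) \<noteq> (W s * W s) $$ (j, j)))" for i j
    using one_neq_zero by blast
  then obtain g where g: "\<And>i j. g i j \<noteq> 0" "\<And>i j s. i < N \<Longrightarrow> j < N \<Longrightarrow> j \<notin> {i, \<pi> i} \<Longrightarrow>
      poly (g i j) s \<noteq> 0 \<Longrightarrow> (W s * W s) $$ (i, i) \<noteq> (W s * W s) $$ (j, j)"
    by metis
  define G where "G = (\<Prod>i<N. \<Prod>j<N. g i j)"
  have G0: "G \<noteq> 0"
    using g(1) by (simp add: G_def)
  have YG: "Y s \<in> generic_part N \<pi>" if "poly G s \<noteq> 0" for s
  proof -
    have "(W s * W s) $$ (i, i) = (W s * W s) $$ (j, j) \<longleftrightarrow> j \<in> {i, \<pi> i}" if ij: "i < N" "j < N" for i j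
    proof
      assume "(W s * W s) $$ (i, i) = (W s * W s) $$ (j, j)"
      moreover have "poly (g i j) s \<noteq> 0"
        using \<open>poly G s \<noteq> 0\<close> ij by (auto simp: G_def poly_prod)
      ultimately show "j \<in> {i, \<pi> i}"
        using g(2) ij by blast
    next
      \<comment> \<open>This half holds for every \<open>s\<close>, as the diagonal value of the
        square is symmetric under exchanging \<open>i\<close> and \<open>\<pi> i\<close>.\<close>
      assume "j \<in> {i, \<pi> i}"
      then show "(W s * W s) $$ (i, i) = (W s * W s) $$ (j, j)"
        using ij pi unfolding W_def
        by (auto simp: underline_perm_times_brauer(2)[OF lp(1) diagonal_line[OF t u]])
    qed
    then show ?thesis
      using YE by (auto simp: generic_part_def)
  qed
  have "Y 0 \<in> zariski N closure_of generic_part N \<pi>"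
  proof (rule closure_of_zariskiI)
    fix f assume f: "f \<in> poly_funs N" "\<And>X. X \<in> generic_part N \<pi> \<inter> carrier_mat N N \<Longrightarrow> f X = 0"
    obtain p where p: "\<And>s. f (Y s) = poly p s"
      using poly_funs_poly_curve[OF f(1) Y] by blast
    \<comment> \<open>Where \<open>G\<close> is nonzero, \<open>Y s\<close> is generic and
      \<open>f\<close> vanishes there; elsewhere the factor \<open>G\<close> is zero.\<close>
    have "poly (p * G) s = 0" for s
      using f(2)[of "Y s"] YG[of s] p poly_curve_carrier[OF Y, of s] by auto
    then have "p * G = 0"
      using poly_all_0_iff_0 by blast
    then show "f (Y 0) = 0"
      using G0 p by simp
  qed (rule poly_curve_carrier[OF Y])
  then show "M \<in> zariski N closure_of generic_part N \<pi>"
    by (simp add: Y_def W0 M)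
qed

section \<open>Irreducibility of the orbit\<close>

text \<open>Any two orbit points are joined by a polynomial curve inside the orbit. If two proper
  closed subsets covered it, equations nonzero at the two ends would have product zero along the
  curve, which is impossible in a domain.\<close>

lemma irreducible_pattern_orbit:
  "irreducible_space (subtopology (zariski N) (pattern_orbit N \<pi>))"
proof -
  let ?S = "pattern_orbit N \<pi>"
  have top: "topspace (subtopology (zariski N) ?S) = ?S"
    using pattern_orbit_carrier[of N \<pi>] by (auto simp: topspace_zariski)
  have "1\<^sub>m N \<star> (underline_perm N \<pi> * 0\<^sub>m N N) \<star> bullet_inv N (1\<^sub>m N) \<in> ?S"
    unfolding pattern_orbit_iff using unit_diag_group_one
    by (intro exI[of _ "1\<^sub>m N"] exI[of _ "0\<^sub>m N N"]) (auto simp: diagonal_mat_def)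
  then have ne: "?S \<noteq> {}" by blast
  have "A = ?S \<or> B = ?S"
    if A: "closedin (subtopology (zariski N) ?S) A" and B: "closedin (subtopology (zariski N) ?S) B"
      and AB: "A \<union> B = ?S" for A B
  proof (rule ccontr)
    assume neg: "\<not> (A = ?S \<or> B = ?S)"
    obtain F where F: "F \<subseteq> poly_funs N" "A = zero_locus N F \<inter> ?S"
      using A by (auto simp: closedin_subtopology closedin_zariski)
    obtain G where G: "G \<subseteq> poly_funs N" "B = zero_locus N G \<inter> ?S"
      using B by (auto simp: closedin_subtopology closedin_zariski)
    obtain X f where X: "X \<in> ?S" "f \<in> F" "f X \<noteq> 0"
      using neg F(2) pattern_orbit_carrier[of N \<pi>] unfolding zero_locus_def by blast
    obtain Y g where Y: "Y \<in> ?S" "g \<in> G" "g Y \<noteq> 0"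
      using neg G(2) pattern_orbit_carrier[of N \<pi>] unfolding zero_locus_def by blast
    obtain P t where P: "P \<in> unit_diag_group N" and t: "t \<in> carrier_mat N N" "diagonal_mat t"
      and Xe: "X = P \<star> (underline_perm N \<pi> * t) \<star> bullet_inv N P"
      using X(1) by (auto simp: pattern_orbit_iff)
    obtain Q u where Q: "Q \<in> unit_diag_group N" and u: "u \<in> carrier_mat N N" "diagonal_mat u"
      and Ye: "Y = Q \<star> (underline_perm N \<pi> * u) \<star> bullet_inv N Q"
      using Y(1) by (auto simp: pattern_orbit_iff)
    note p = unit_diag_groupD(1)[OF P] and q = unit_diag_groupD(1)[OF Q]
    \<comment> \<open>U is an affine subspace, so the line from \<open>P\<close> to \<open>Q\<close>
      stays in it. That \<open>bullet_inv N (V s)\<close> is again polynomial in \<open>s\<close>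
      makes \<open>Z\<close> a polynomial curve.\<close>
    define V where "V s = P + s \<cdot>\<^sub>m (Q - P)" for s
    define Z where "Z s = V s \<star> (underline_perm N \<pi> * (t + s \<cdot>\<^sub>m (u - t))) \<star> bullet_inv N (V s)" for s
    have V: "poly_curve N V" "V s \<in> unit_diag_group N" for s
      unfolding V_def using poly_curve_line[OF p q] P Q by (auto simp: unit_diag_group_def)
    have Z: "poly_curve N Z"
      unfolding Z_def
      by (intro poly_curve_bullet V poly_curve_pattern poly_curve_line t u poly_curve_bullet_inv(1))
    have ZS: "Z s \<in> ?S" for s
      unfolding pattern_orbit_iff Z_def using V(2) diagonal_line[OF t u] by blast
    have Z01: "Z 0 = X" "Z 1 = Y"
      unfolding Z_def V_def Xe Ye line_ends[OF p q] line_ends[OF t(1) u(1)] by simp_all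
    obtain a where a: "\<And>s. f (Z s) = poly a s"
      using poly_funs_poly_curve[OF _ Z] F(1) X(2) by blast
    obtain b where b: "\<And>s. g (Z s) = poly b s"
      using poly_funs_poly_curve[OF _ Z] G(1) Y(2) by blast
    have "poly (a * b) s = 0" for s
    proof -
      have "Z s \<in> A \<or> Z s \<in> B"
        using ZS[of s] AB by blast
      then show ?thesis
        using F(2) G(2) X(2) Y(2) a[of s] b[of s] by (auto simp: zero_locus_def)
    qed
    then have "a * b = 0"
      using poly_all_0_iff_0 by blast
    then show False
      using X(3) Y(3) a[of 0] b[of 1] Z01 by auto
  qed
  then show ?thesis
    unfolding irreducible_space_def top using ne by blast
qed

theorem proposition3:
  fixes N n r :: nat and \<pi> :: "nat \<Rightarrow> nat"
  assumes "N = 2 * n + r" and "r \<in> {0, 1}" and "N > 0"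
    and "link_pattern N r \<pi>"
  shows "let S = bullet_orbit N {underline_perm N \<pi> * t | t. t \<in> carrier_mat N N \<and> diagonal_mat t}
    in irreducible_space (subtopology (zariski N) S) \<and>
       S \<subseteq> brauer_component N \<pi> \<and>
       subtopology (zariski N) (brauer_component N \<pi>) closure_of S = brauer_component N \<pi> \<and>
       brauer_component N \<pi> = zariski N closure_of S"
proof -
  let ?S = "pattern_orbit N \<pi>"
  have comp: "brauer_component N \<pi> = zariski N closure_of generic_part N \<pi>"
    unfolding brauer_component_def generic_part_def ..
  have sub: "?S \<subseteq> brauer_component N \<pi>"
    unfolding comp by (rule pattern_orbit_subset_closure[OF assms(4,2)])
  have cl: "brauer_component N \<pi> = zariski N closure_of ?S"
  proof
    show "brauer_component N \<pi> \<subseteq> zariski N closure_of ?S"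
      unfolding comp by (rule closure_of_mono[OF generic_part_subset_orbit[OF assms(4)]])
    show "zariski N closure_of ?S \<subseteq> brauer_component N \<pi>"
      using closure_of_minimal[OF sub] unfolding comp by simp
  qed
  \<comment> \<open>Since the component contains the orbit, the relative closure is the ambient
    closure intersected with the component.\<close>
  moreover have "subtopology (zariski N) (brauer_component N \<pi>) closure_of ?S = brauer_component N \<pi>"
    using sub cl by (simp add: closure_of_subtopology Int_absorb1)
  ultimately show ?thesis
    unfolding Let_def using irreducible_pattern_orbit sub by blast
qed

end
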